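(* Let $(X,T)$ be a dynamical system. Then the following statements are equivalent: (1) $(X,T)$ is equicontinuous; (2) $(K(X),T_K)$ is equicontinuous; (3) $(\mathbb{F}_0(X),T_F)$ is equicontinuous.
   Context: A dynamical system $(X,T)$ consists of a nontrivial (more than one point) compact metric space $X$ with metric $d$ and a continuous surjection $T:X\to X$. $I=[0,1]$, $\mathbb{Z}^+=\{0,1,2,\dots\}$. Hyperspace: $K(X)$ is the set of all nonempty closed subsets of $X$ with the Hausdorff metric $d_H(A,B)=\max\{\max_{x\in A}\min_{y\in B}d(x,y),\max_{y\in B}\min_{x\in A}d(x,y)\}$, and $T_K:K(X)\to K(X)$ is $T_K(A)=T(A)$. Extend $d_H$ to the empty set by $d_H(\emptyset,\emptyset)=0$ and $d_H(\emptyset,A)=d_H(A,\emptyset)=\mathrm{diam}(X)$ for $A\in K(X)$. Fuzzy sets: $\mathbb{F}(X)$ is the set of all upper semicontinuous functions $A:X\to I$, and $\mathbb{F}_0(X)$ is the set of those $A\in\mathbb{F}(X)$ that are nonempty, i.e. not identically $0$. For $\alpha\in I$, $[A]_\alpha=\{x\in X:A(x)\ge\alpha\}$. The levelwise metric on $\mathbb{F}(X)$ (and on its subsets) is $d_\infty(A,B)=\sup\{d_H([A]_\alpha,[B]_\alpha):\alpha\in(0,1]\}$. Zadeh's extension $T_F$ is $T_F(A)(x)=\sup\{A(y):y\in T^{-1}(x)\}$; it maps $\mathbb{F}_0(X)$ to itself. For a self-map $S$ of a metric space $(Y,\rho)$, $(Y,S)$ is equicontinuous if for every $\varepsilon>0$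 there is $\delta>0$ such that for all $x,y\in Y$ with $\rho(x,y)<\delta$ and all $n\in\mathbb{Z}^+$, $\rho(S^n(x),S^n(y))<\varepsilon$. *)

theory Defs
  imports "HOL-Analysis.Analysis"
begin

text \<open>The phase space is a whole type of class \<open>metric_space\<close>, with \<open>dist\<close> as its metric.\<close>

definition dynamical_system :: "('a::metric_space \<Rightarrow> 'a) \<Rightarrow> bool" where
  "dynamical_system T \<longleftrightarrow>
     compact (UNIV :: 'a set) \<and> (\<exists>x y :: 'a. x \<noteq> y) \<and> continuous_on UNIV T \<and> surj T"

definition equicontinuous :: "'b set \<Rightarrow> ('b \<Rightarrow> 'b \<Rightarrow> real) \<Rightarrow> ('b \<Rightarrow> 'b) \<Rightarrow> bool" where
  "equicontinuous Y \<rho> S \<longleftrightarrow>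
     (\<forall>\<epsilon>>0. \<exists>\<delta>>0. \<forall>x\<in>Y. \<forall>y\<in>Y. \<rho> x y < \<delta> \<longrightarrow> (\<forall>n::nat. \<rho> ((S ^^ n) x) ((S ^^ n) y) < \<epsilon>))"

definition hyperspace :: "'a::metric_space set set" where
  "hyperspace = {A. A \<noteq> {} \<and> closed A}"

text \<open>The Hausdorff metric, extended to the empty set. On nonempty closed subsets of a compact
  space all suprema and infima involved are attained, so they are the maxima and minima of the
  usual definition; \<open>infdist x B\<close> is the infimum of \<open>dist x y\<close> over \<open>y \<in> B\<close> when \<open>B\<close> is nonempty.\<close>

definition hausdorff_dist :: "'a::metric_space set \<Rightarrow> 'a set \<Rightarrow> real" where
  "hausdorff_dist A B =
     (if A = {} \<and> B = {} then 0
      else if A = {} \<or> B = {} then diameter (UNIV :: 'a set)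
      else max (SUP x\<in>A. infdist x B) (SUP y\<in>B. infdist y A))"

definition hyper_map :: "('a \<Rightarrow> 'a) \<Rightarrow> 'a set \<Rightarrow> 'a set" where
  "hyper_map T A = T ` A"

definition upper_semicontinuous :: "('a::topological_space \<Rightarrow> real) \<Rightarrow> bool" where
  "upper_semicontinuous f \<longleftrightarrow> (\<forall>x. \<forall>c > f x. \<forall>\<^sub>F y in nhds x. f y < c)"

definition fuzzy_sets :: "('a::metric_space \<Rightarrow> real) set" where
  "fuzzy_sets = {A. (\<forall>x. A x \<in> {0..1}) \<and> upper_semicontinuous A}"

definition nonempty_fuzzy_sets :: "('a::metric_space \<Rightarrow> real) set" where
  "nonempty_fuzzy_sets = {A \<in> fuzzy_sets. \<exists>x. A x \<noteq> 0}"

definition level_set :: "('a \<Rightarrow> real) \<Rightarrow> real \<Rightarrow> 'a set" where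
  "level_set A \<alpha> = {x. A x \<ge> \<alpha>}"

definition levelwise_dist :: "('a::metric_space \<Rightarrow> real) \<Rightarrow> ('a \<Rightarrow> real) \<Rightarrow> real" where
  "levelwise_dist A B = (SUP \<alpha>\<in>{0<..1}. hausdorff_dist (level_set A \<alpha>) (level_set B \<alpha>))"

definition zadeh_extension :: "('a \<Rightarrow> 'a) \<Rightarrow> ('a \<Rightarrow> real) \<Rightarrow> 'a \<Rightarrow> real" where
  "zadeh_extension T A x = (SUP y\<in>T -` {x}. A y)"

end

theory Submission
  imports Defs
begin

text \<open>A point is a singleton and a closed set is a crisp fuzzy set, isometrically and equivariantly,
  so (3) implies (2) and (2) implies (1). An equicontinuity estimate for points passes to the images
  of two close closed sets, which gives (2). Finally, by compactness the supremum in Zadeh's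
  extension is attained, so its \<open>\<alpha>\<close>-cut is exactly the image of the \<open>\<alpha>\<close>-cut; applying (2) to all
  cuts simultaneously gives (3).\<close>

section \<open>Estimates for the Hausdorff distance\<close>

lemma hausdorff_distI:
  fixes A B :: "'a::metric_space set"
  assumes "A \<noteq> {}" "B \<noteq> {}"
    and "\<And>x. x \<in> A \<Longrightarrow> \<exists>y\<in>B. dist x y \<le> e"
    and "\<And>y. y \<in> B \<Longrightarrow> \<exists>x\<in>A. dist y x \<le> e"
  shows "hausdorff_dist A B \<le> e"
proof -
  have "infdist x B \<le> e" if "x \<in> A" for x
    using assms(3)[OF that] by (auto intro: infdist_le2)
  moreover have "infdist y A \<le> e" if "y \<in> B" for y
    using assms(4)[OF that] by (auto intro: infdist_le2)
  ultimately have "(SUP x\<in>A. infdist x B) \<le> e" "(SUP y\<in>B. infdist y A) \<le> e"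
    using assms(1,2) by (auto intro!: cSUP_least)
  then show ?thesis
    using assms(1,2) by (simp add: hausdorff_dist_def)
qed

lemma hausdorff_dist_commute: "hausdorff_dist A B = hausdorff_dist B A"
  by (auto simp: hausdorff_dist_def max.commute)

text \<open>Strictness does the work of attainment: an infimum below \<open>e\<close> has a member
  below \<open>e\<close>. Boundedness of the space lets the outer supremum dominate each of its
  terms.\<close>

lemma hausdorff_distD:
  fixes A B :: "'a::metric_space set"
  assumes bdd: "bounded (UNIV :: 'a set)" and "B \<noteq> {}"
    and less: "hausdorff_dist A B < e" and x: "x \<in> A"
  shows "\<exists>y\<in>B. dist x y < e"
proof -
  obtain b where "b \<in> B" using \<open>B \<noteq> {}\<close> by blast
  then have "infdist z B \<le> diameter (UNIV :: 'a set)" for z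
    using diameter_bounded_bound[OF bdd, of z b] by (intro infdist_le2) auto
  then have "bdd_above ((\<lambda>z. infdist z B) ` A)"
    by (rule bdd_aboveI2)
  then have "infdist x B \<le> (SUP x\<in>A. infdist x B)"
    using x by (rule cSUP_upper2) simp
  also have "\<dots> \<le> hausdorff_dist A B"
    using x \<open>B \<noteq> {}\<close> by (auto simp: hausdorff_dist_def)
  finally have "(INF y\<in>B. dist x y) < e"
    using less \<open>B \<noteq> {}\<close> by (simp add: infdist_def)
  then show ?thesis
    using \<open>B \<noteq> {}\<close> by (subst (asm) cINF_less_iff) auto
qed

text \<open>Serves to bound the distances between cuts uniformly in the level, so that the supremum
  in \<open>levelwise_dist\<close> dominates each of them.\<close>

lemma hausdorff_dist_le_diameter:
  fixes A B :: "'a::metric_space set"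
  assumes "bounded (UNIV :: 'a set)"
  shows "hausdorff_dist A B \<le> diameter (UNIV :: 'a set)"
proof (cases "A = {} \<or> B = {}")
  case True
  then show ?thesis
    using assms by (auto simp: hausdorff_dist_def diameter_ge_0)
next
  case False
  then show ?thesis
    using diameter_bounded_bound[OF assms] by (intro hausdorff_distI) blast+
qed

lemma hausdorff_dist_singleton: "hausdorff_dist {x} {y} = dist x y"
  by (simp add: hausdorff_dist_def dist_commute)

section \<open>Equicontinuity for points and for closed sets\<close>

lemma hyper_map_funpow: "(hyper_map T ^^ n) A = (T ^^ n) ` A"
  by (induction n) (auto simp: hyper_map_def)

lemma equicontinuous_hyperspaceI:
  fixes T :: "'a::metric_space \<Rightarrow> 'a"
  assumes bdd: "bounded (UNIV :: 'a set)" and eq: "equicontinuous UNIV dist T"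
  shows "equicontinuous hyperspace hausdorff_dist (hyper_map T)"
  unfolding equicontinuous_def
proof (intro allI impI)
  fix e :: real assume "e > 0"
  \<comment> \<open>Suprema preserve only non-strict bounds; halving \<open>e\<close> recovers the
    strict one at the end.\<close>
  then obtain d where "d > 0"
    and d: "\<And>x y n. dist x y < d \<Longrightarrow> dist ((T ^^ n) x) ((T ^^ n) y) < e / 2"
    using eq unfolding equicontinuous_def by (metis UNIV_I half_gt_zero)
  have "hausdorff_dist ((hyper_map T ^^ n) A) ((hyper_map T ^^ n) B) < e"
    if "A \<in> hyperspace" "B \<in> hyperspace" "hausdorff_dist A B < d" for A B n
  proof -
    have ne: "A \<noteq> {}" "B \<noteq> {}" using that by (auto simp: hyperspace_def)
    \<comment> \<open>Stated for an arbitrary pair, so that it covers both directions of the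
      Hausdorff distance.\<close>
    have close: "\<exists>v\<in>(T ^^ n) ` D. dist u v \<le> e / 2"
      if "D \<noteq> {}" "hausdorff_dist C D < d" "u \<in> (T ^^ n) ` C" for C D :: "'a set" and u
    proof -
      obtain x where x: "x \<in> C" "u = (T ^^ n) x"
        using \<open>u \<in> (T ^^ n) ` C\<close> by blast
      then obtain y where "y \<in> D" "dist x y < d"
        using hausdorff_distD[OF bdd \<open>D \<noteq> {}\<close> \<open>hausdorff_dist C D < d\<close>] by blast
      then show ?thesis using less_imp_le[OF d[of x y n]] x by blast
    qed
    have "hausdorff_dist ((T ^^ n) ` A) ((T ^^ n) ` B) \<le> e / 2"
      using ne close[of B A] close[of A B] that hausdorff_dist_commute[of A B]
      by (intro hausdorff_distI) auto
    then show ?thesis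
      using \<open>e > 0\<close> by (simp add: hyper_map_funpow)
  qed
  then show "\<exists>d>0. \<forall>A\<in>hyperspace. \<forall>B\<in>hyperspace. hausdorff_dist A B < d \<longrightarrow>
      (\<forall>n. hausdorff_dist ((hyper_map T ^^ n) A) ((hyper_map T ^^ n) B) < e)"
    using \<open>d > 0\<close> by blast
qed

text \<open>Transfers equicontinuity back along an embedding \<open>f\<close>, here singletons and
  then indicators. Equivariance enters only through distances between iterates, and the case
  \<open>n = 0\<close> is the isometry that carries \<delta> over.\<close>

lemma equicontinuous_pullback:
  assumes eq: "equicontinuous Z \<sigma> S"
    and "\<And>x. x \<in> Y \<Longrightarrow> f x \<in> Z"
    and iso: "\<And>x y n. x \<in> Y \<Longrightarrow> y \<in> Y \<Longrightarrow>
      \<sigma> ((S ^^ n) (f x)) ((S ^^ n) (f y)) = \<rho> ((R ^^ n) x) ((R ^^ n) y)"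
  shows "equicontinuous Y \<rho> R"
  unfolding equicontinuous_def
proof (intro allI impI)
  fix e :: real assume "e > 0"
  then obtain d where "d > 0" and d: "\<And>x y n. x \<in> Z \<Longrightarrow> y \<in> Z \<Longrightarrow> \<sigma> x y < d \<Longrightarrow>
      \<sigma> ((S ^^ n) x) ((S ^^ n) y) < e"
    using eq unfolding equicontinuous_def by metis
  have "\<rho> ((R ^^ n) x) ((R ^^ n) y) < e" if "x \<in> Y" "y \<in> Y" "\<rho> x y < d" for x y n
    using d[of "f x" "f y" n] iso[of x y n] iso[of x y 0] that assms(2) by simp
  then show "\<exists>d>0. \<forall>x\<in>Y. \<forall>y\<in>Y. \<rho> x y < d \<longrightarrow> (\<forall>n. \<rho> ((R ^^ n) x) ((R ^^ n) y) < e)"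
    using \<open>d > 0\<close> by blast
qed

lemma equicontinuous_hyperspaceD:
  fixes T :: "'a::metric_space \<Rightarrow> 'a"
  assumes "equicontinuous hyperspace hausdorff_dist (hyper_map T)"
  shows "equicontinuous UNIV dist T"
  using assms
  by (rule equicontinuous_pullback[where f = "\<lambda>x. {x}"])
    (auto simp: hyperspace_def hyper_map_funpow hausdorff_dist_singleton)

section \<open>Upper semicontinuity and the cuts of Zadeh's extension\<close>

text \<open>The complement of a cut is a strict sublevel set, and its openness, tested point by
  point, is the defining condition. Closed cuts are the form that passes to images under a
  continuous map on a compact space.\<close>

lemma upper_semicontinuous_iff_closed:
  "upper_semicontinuous f \<longleftrightarrow> (\<forall>c. closed (level_set f c))"
proof -
  have compl: "- level_set f c = {x. f x < c}" for c
    by (auto simp: level_set_def)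
  have "closed (level_set f c) \<longleftrightarrow> (\<forall>x. f x < c \<longrightarrow> (\<forall>\<^sub>F y in nhds x. f y < c))" for c
    unfolding closed_def compl eventually_nhds
    by (subst open_subopen) (simp add: subset_iff Ball_def)
  then show ?thesis
    unfolding upper_semicontinuous_def by blast
qed

text \<open>Without a maximum, the open sets where \<open>f\<close> is below \<open>f z\<close>, for
  \<open>z\<close> in \<open>C\<close>, cover \<open>C\<close>. In a finite subcover, the index with
  the largest value lies in none of the sets.\<close>

lemma upper_semicontinuous_attains_sup:
  assumes usc: "upper_semicontinuous f" and "compact C" "C \<noteq> {}"
  shows "\<exists>y\<in>C. \<forall>z\<in>C. f z \<le> f y"
proof (rule ccontr)
  assume "\<not> ?thesis"
  then have cover: "C \<subseteq> (\<Union>z\<in>C. - level_set f (f z))"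
    by (fastforce simp: level_set_def not_le)
  have "open (- level_set f c)" for c
    using usc by (simp add: upper_semicontinuous_iff_closed open_Compl)
  then obtain F where F: "F \<subseteq> C" "finite F" "C \<subseteq> (\<Union>z\<in>F. - level_set f (f z))"
    using compactE_image[OF \<open>compact C\<close> _ cover] by metis
  then have "F \<noteq> {}" using \<open>C \<noteq> {}\<close> by blast
  then have "Max (f ` F) \<in> f ` F"
    using F(2) by (intro Max_in) auto
  then obtain m where "m \<in> F" "f m = Max (f ` F)" by force
  then have "f z \<le> f m" if "z \<in> F" for z
    using F(2) that by simp
  then show False using F \<open>m \<in> F\<close> by (force simp: level_set_def)
qed

text \<open>Fibres are compact, and nonempty by surjectivity, so some point of the fibre realises
  the value of the extension. The level is any real number; levels 0 and above 1 are used
  below.\<close>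

lemma level_set_zadeh_extension:
  fixes T :: "'a::metric_space \<Rightarrow> 'a"
  assumes T: "dynamical_system T" and A: "A \<in> fuzzy_sets"
  shows "level_set (zadeh_extension T A) \<alpha> = T ` level_set A \<alpha>"
proof -
  have "zadeh_extension T A x \<ge> \<alpha> \<longleftrightarrow> (\<exists>y. T y = x \<and> A y \<ge> \<alpha>)" for x
  proof -
    have "closed (T -` {x})"
      using T by (auto simp: dynamical_system_def intro: closed_vimage)
    then have "compact (T -` {x})"
      using T compact_Int_closed[of UNIV] by (auto simp: dynamical_system_def)
    moreover have "T -` {x} \<noteq> {}"
      using T unfolding dynamical_system_def surj_def by (metis empty_iff vimage_singleton_eq)
    ultimately obtain y where y: "T y = x" "\<And>z. T z = x \<Longrightarrow> A z \<le> A y"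
      using upper_semicontinuous_attains_sup[of A "T -` {x}"] A by (auto simp: fuzzy_sets_def)
    have "zadeh_extension T A x = A y"
      unfolding zadeh_extension_def using y by (intro cSup_eq_maximum) auto
    then show ?thesis using y order_trans by metis
  qed
  then show ?thesis
    by (auto simp: level_set_def image_iff)
qed

text \<open>Everything is read off from the cut identity: cuts are images of compact sets, hence
  closed; the cut at 0 is the image of the whole space; cuts above 1 are empty; a point of positive
  value is sent to one of positive value.\<close>

lemma zadeh_extension_nonempty_fuzzy:
  fixes T :: "'a::metric_space \<Rightarrow> 'a"
  assumes T: "dynamical_system T" and A: "A \<in> nonempty_fuzzy_sets"
  shows "zadeh_extension T A \<in> nonempty_fuzzy_sets"
proof -
  have A': "A \<in> fuzzy_sets" using A by (simp add: nonempty_fuzzy_sets_def)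
  note level = level_set_zadeh_extension[OF T A']
  have "closed (level_set (zadeh_extension T A) c)" for c
  proof -
    have "closed (level_set A c)"
      using A' by (simp add: fuzzy_sets_def upper_semicontinuous_iff_closed)
    then have "compact (level_set A c)"
      using T compact_Int_closed[of UNIV] by (auto simp: dynamical_system_def)
    then show ?thesis
      using T unfolding level
      by (intro compact_imp_closed compact_continuous_image)
        (auto simp: dynamical_system_def intro: continuous_on_subset)
  qed
  moreover have "zadeh_extension T A x \<ge> 0" for x
  proof -
    have "level_set A 0 = UNIV" using A' by (auto simp: fuzzy_sets_def level_set_def)
    then show ?thesis using T level[of 0] by (auto simp: level_set_def dynamical_system_def)
  qed
  moreover have "zadeh_extension T A x \<le> 1" for x
  proof (rule ccontr)
    assume "\<not> zadeh_extension T A x \<le> 1"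
    then have "x \<in> T ` level_set A (zadeh_extension T A x)"
      unfolding level[symmetric] by (simp add: level_set_def)
    then obtain y where "A y \<ge> zadeh_extension T A x" by (auto simp: level_set_def)
    moreover have "A y \<le> 1" using A' by (auto simp: fuzzy_sets_def)
    ultimately show False using \<open>\<not> zadeh_extension T A x \<le> 1\<close> by linarith
  qed
  moreover have "\<exists>x. zadeh_extension T A x \<noteq> 0"
  proof -
    obtain y where y: "A y \<noteq> 0" using A by (auto simp: nonempty_fuzzy_sets_def)
    then have "A y > 0" using A' by (auto simp: fuzzy_sets_def order_less_le)
    moreover have "T y \<in> level_set (zadeh_extension T A) (A y)"
      unfolding level by (simp add: level_set_def)
    ultimately show ?thesis by (auto simp: level_set_def intro!: exI[of _ "T y"])
  qed
  ultimately show ?thesis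
    by (simp add: nonempty_fuzzy_sets_def fuzzy_sets_def upper_semicontinuous_iff_closed)
qed

text \<open>Membership is carried through the induction because the cut identity is applied to a
  fuzzy set at each step.\<close>

lemma zadeh_extension_funpow:
  fixes T :: "'a::metric_space \<Rightarrow> 'a"
  assumes T: "dynamical_system T" and A: "A \<in> nonempty_fuzzy_sets"
  shows "(zadeh_extension T ^^ n) A \<in> nonempty_fuzzy_sets
    \<and> level_set ((zadeh_extension T ^^ n) A) \<alpha> = (T ^^ n) ` level_set A \<alpha>"
proof (induction n)
  case 0
  then show ?case using A by simp
next
  case (Suc n)
  then show ?case
    using zadeh_extension_nonempty_fuzzy[OF T] level_set_zadeh_extension[OF T]
    by (simp add: nonempty_fuzzy_sets_def image_comp)
qed

section \<open>Equicontinuity for closed sets and for fuzzy sets\<close>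

lemma indicator_nonempty_fuzzy:
  fixes A :: "'a::metric_space set"
  assumes "A \<in> hyperspace"
  shows "indicator A \<in> nonempty_fuzzy_sets"
proof -
  have "level_set (indicator A :: 'a \<Rightarrow> real) c = (if c \<le> 0 then UNIV else if c \<le> 1 then A else {})" for c
    by (auto simp: level_set_def indicator_def)
  then show ?thesis
    using assms
    by (auto simp: nonempty_fuzzy_sets_def fuzzy_sets_def hyperspace_def
        upper_semicontinuous_iff_closed indicator_def)
qed

text \<open>All cuts of an indicator at levels in (0,1] coincide, and this persists under iteration,
  so the supremum runs over a constant family.\<close>

lemma levelwise_dist_zadeh_indicator:
  fixes T :: "'a::metric_space \<Rightarrow> 'a"
  assumes T: "dynamical_system T" and "A \<in> hyperspace" "B \<in> hyperspace"
  shows "levelwise_dist ((zadeh_extension T ^^ n) (indicator A)) ((zadeh_extension T ^^ n) (indicator B))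
    = hausdorff_dist ((hyper_map T ^^ n) A) ((hyper_map T ^^ n) B)"
proof -
  have "level_set (indicator C :: 'a \<Rightarrow> real) \<alpha> = C" if "\<alpha> \<in> {0<..1}" for \<alpha> C
    using that by (auto simp: level_set_def indicator_def)
  then have "level_set ((zadeh_extension T ^^ n) (indicator C)) \<alpha> = (hyper_map T ^^ n) C"
    if "\<alpha> \<in> {0<..1}" "C \<in> hyperspace" for \<alpha> C
    using zadeh_extension_funpow[OF T indicator_nonempty_fuzzy] that by (simp add: hyper_map_funpow)
  then have "levelwise_dist ((zadeh_extension T ^^ n) (indicator A)) ((zadeh_extension T ^^ n) (indicator B))
    = (SUP \<alpha>\<in>{0<..1::real}. hausdorff_dist ((hyper_map T ^^ n) A) ((hyper_map T ^^ n) B))"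
    using assms(2,3) unfolding levelwise_dist_def by (intro SUP_cong) auto
  then show ?thesis by simp
qed

lemma hausdorff_dist_le_levelwise_dist:
  fixes A B :: "'a::metric_space \<Rightarrow> real"
  assumes "bounded (UNIV :: 'a set)" "\<alpha> \<in> {0<..1}"
  shows "hausdorff_dist (level_set A \<alpha>) (level_set B \<alpha>) \<le> levelwise_dist A B"
  unfolding levelwise_dist_def
  using hausdorff_dist_le_diameter[OF assms(1)] assms(2)
  by (intro cSUP_upper) (auto intro!: bdd_aboveI)

lemma equicontinuous_fuzzyI:
  fixes T :: "'a::metric_space \<Rightarrow> 'a"
  assumes T: "dynamical_system T"
    and eq: "equicontinuous hyperspace hausdorff_dist (hyper_map T)"
  shows "equicontinuous nonempty_fuzzy_sets levelwise_dist (zadeh_extension T)"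
  unfolding equicontinuous_def
proof (intro allI impI)
  fix e :: real assume "e > 0"
  \<comment> \<open>The modulus \<open>d\<close> is independent of the sets, so one choice serves
    all levels; \<open>e / 2\<close> leaves room for the supremum over them.\<close>
  then obtain d where "d > 0" and d: "\<And>A B n. A \<in> hyperspace \<Longrightarrow> B \<in> hyperspace \<Longrightarrow>
      hausdorff_dist A B < d \<Longrightarrow>
      hausdorff_dist ((hyper_map T ^^ n) A) ((hyper_map T ^^ n) B) < e / 2"
    using eq unfolding equicontinuous_def by (metis half_gt_zero)
  have bdd: "bounded (UNIV :: 'a set)"
    using T by (simp add: dynamical_system_def compact_imp_bounded)
  \<comment> \<open>Nontriviality of the space makes the diameter an admissible bound for
    \<delta>.\<close>
  obtain x y :: 'a where "x \<noteq> y" using T by (auto simp: dynamical_system_def)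
  then have diam: "diameter (UNIV :: 'a set) > 0"
    using diameter_bounded_bound[OF bdd, of x y] by (simp add: less_le_trans[of 0 "dist x y"])
  \<comment> \<open>Below the diameter, an empty cut is only close to an empty cut.\<close>
  define d' where "d' = min d (diameter (UNIV :: 'a set))"
  have "levelwise_dist ((zadeh_extension T ^^ n) A) ((zadeh_extension T ^^ n) B) < e"
    if A: "A \<in> nonempty_fuzzy_sets" and B: "B \<in> nonempty_fuzzy_sets"
      and less: "levelwise_dist A B < d'" for A B n
  proof -
    have "hausdorff_dist (level_set ((zadeh_extension T ^^ n) A) \<alpha>)
        (level_set ((zadeh_extension T ^^ n) B) \<alpha>) \<le> e / 2" if \<alpha>: "\<alpha> \<in> {0<..1}" for \<alpha>
    proof -
      let ?A = "level_set A \<alpha>" and ?B = "level_set B \<alpha>"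
      have close: "hausdorff_dist ?A ?B < d'"
        using hausdorff_dist_le_levelwise_dist[OF bdd \<alpha>, of A B] less by linarith
      have "closed ?A" "closed ?B"
        using A B by (auto simp: nonempty_fuzzy_sets_def fuzzy_sets_def upper_semicontinuous_iff_closed)
      have "hausdorff_dist ((T ^^ n) ` ?A) ((T ^^ n) ` ?B) \<le> e / 2"
      proof (cases "?A = {} \<or> ?B = {}")
        case True
        then have "?A = {} \<and> ?B = {}"
          using close by (auto simp: hausdorff_dist_def d'_def split: if_splits)
        then show ?thesis using \<open>e > 0\<close> by (simp add: hausdorff_dist_def)
      next
        case False
        then show ?thesis
          using d[of ?A ?B n] close \<open>closed ?A\<close> \<open>closed ?B\<close>
          by (simp add: hyperspace_def hyper_map_funpow d'_def)
      qed
      then show ?thesis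
        using zadeh_extension_funpow[OF T] A B by simp
    qed
    then have "levelwise_dist ((zadeh_extension T ^^ n) A) ((zadeh_extension T ^^ n) B) \<le> e / 2"
      unfolding levelwise_dist_def by (intro cSUP_least) auto
    then show ?thesis using \<open>e > 0\<close> by linarith
  qed
  moreover have "d' > 0" using \<open>d > 0\<close> diam by (simp add: d'_def)
  ultimately show "\<exists>d>0. \<forall>A\<in>nonempty_fuzzy_sets. \<forall>B\<in>nonempty_fuzzy_sets. levelwise_dist A B < d \<longrightarrow>
      (\<forall>n. levelwise_dist ((zadeh_extension T ^^ n) A) ((zadeh_extension T ^^ n) B) < e)"
    by blast
qed

lemma equicontinuous_fuzzyD:
  fixes T :: "'a::metric_space \<Rightarrow> 'a"
  assumes "dynamical_system T"
    and "equicontinuous nonempty_fuzzy_sets levelwise_dist (zadeh_extension T)"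
  shows "equicontinuous hyperspace hausdorff_dist (hyper_map T)"
  by (rule equicontinuous_pullback[where f = indicator, OF assms(2) indicator_nonempty_fuzzy
        levelwise_dist_zadeh_indicator[OF assms(1)]])

theorem theorem6:
  fixes T :: "'a::metric_space \<Rightarrow> 'a"
  assumes "dynamical_system T"
  shows "(equicontinuous UNIV dist T
            \<longleftrightarrow> equicontinuous hyperspace hausdorff_dist (hyper_map T))
       \<and> (equicontinuous hyperspace hausdorff_dist (hyper_map T)
            \<longleftrightarrow> equicontinuous nonempty_fuzzy_sets levelwise_dist (zadeh_extension T))"
proof -
  have "bounded (UNIV :: 'a set)"
    using assms by (simp add: dynamical_system_def compact_imp_bounded)
  then show ?thesis
    using equicontinuous_hyperspaceI equicontinuous_hyperspaceD
      equicontinuous_fuzzyI[OF assms] equicontinuous_fuzzyD[OF assms] by blast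
qed

end
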